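(* Let $X$ be a finite skew brace, $R=\mathfrak{R}_L(X)$ and $Q=X/R$. Suppose that $|Q|=p^a$ for a prime $p$. Then every Sylow $p$-subskew brace $P$ of $X$ supplements $R$. More precisely, $$X=R+P\qquad\text{and}\qquad |P\cap R|=|R|_p.$$ In particular, $R$ has a left-nilpotent supplement.
   Context: A skew (left) brace is a triple $X=(X,+,\cdot)$ such that $(X,+)$ and $(X,\cdot)$ are groups on the same set and $a\cdot(b+c)=a\cdot b-a+a\cdot c$ for all $a,b,c\in X$. A subskew brace is a subset that is a subgroup of both groups. Put $\lambda_a(b)=-a+a\cdot b$ and $a*b=\lambda_a(b)-b$; for subsets $S,T$, $S*T$ is the subgroup of $(X,+)$ generated by all $s*t$, $s\in S$, $t\in T$. An ideal of $X$ is a subgroup of $(X,+)$ that is invariant under every $\lambda_a$ and normal in both $(X,+)$ and $(X,\cdot)$. The left series is $X^1=X$, $X^{n+1}=X*X^n$; $X$ is left nilpotent if $X^n=0$ for some $n$. The left-nilpotent residual $\mathfrak{R}_L(X)$ is the intersection of all ideals $I$ of $X$ such that $X/I$ is left nilpotent. For a positive integer or finite set, the subscript $p$ denotes the $p$-part: $|R|_p$ is the largest power of $p$ dividing $|R|$. A Sylow $p$-subskew brace of $X$ is a subskew brace of order $|X|_p$. A supplement to $R$ is a subskew brace $C\le X$ with $X=R+C$ (set product in $(X,+)$; equivalently $C\to X/R$ is surjective). *)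

theory Defs
  imports "HOL-Algebra.QuotRing" "HOL-Algebra.Generated_Groups" "HOL-Computational_Algebra.Primes"
begin

text \<open>
  A skew brace is carried by the library's \<^type>\<open>ring\<close> record: \<^term>\<open>add_monoid X\<close> is the additive
  group (not assumed commutative) and \<^term>\<open>X\<close> itself, read as a monoid record, is the
  multiplicative group. The equality of the two neutral elements is a consequence of the axioms.
\<close>

locale skew_brace = additive: group "add_monoid X" + multiplicative: group X
  for X :: "('a, 'b) ring_scheme" (structure) +
  assumes brace_distrib:
    "\<lbrakk>a \<in> carrier X; b \<in> carrier X; c \<in> carrier X\<rbrakk>
      \<Longrightarrow> a \<otimes> (b \<oplus> c) = (a \<otimes> b \<ominus> a) \<oplus> a \<otimes> c"

definition subskew_brace :: "('a, 'b) ring_scheme \<Rightarrow> 'a set \<Rightarrow> bool"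
  where "subskew_brace X C \<longleftrightarrow> subgroup C (add_monoid X) \<and> subgroup C X"

definition brace_lambda :: "('a, 'b) ring_scheme \<Rightarrow> 'a \<Rightarrow> 'a \<Rightarrow> 'a"
  where "brace_lambda X a b = (\<ominus>\<^bsub>X\<^esub> a) \<oplus>\<^bsub>X\<^esub> (a \<otimes>\<^bsub>X\<^esub> b)"

definition brace_star :: "('a, 'b) ring_scheme \<Rightarrow> 'a \<Rightarrow> 'a \<Rightarrow> 'a"
  where "brace_star X a b = brace_lambda X a b \<ominus>\<^bsub>X\<^esub> b"

definition brace_set_star :: "('a, 'b) ring_scheme \<Rightarrow> 'a set \<Rightarrow> 'a set \<Rightarrow> 'a set"
  where "brace_set_star X S T = generate (add_monoid X) {brace_star X s t | s t. s \<in> S \<and> t \<in> T}"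

definition brace_ideal :: "('a, 'b) ring_scheme \<Rightarrow> 'a set \<Rightarrow> bool"
  where "brace_ideal X I \<longleftrightarrow>
    subgroup I (add_monoid X) \<and>
    (\<forall>a\<in>carrier X. brace_lambda X a ` I \<subseteq> I) \<and>
    I \<lhd> add_monoid X \<and> I \<lhd> X"

text \<open>
  The index is shifted by one: \<open>left_series X n\<close> is the term $X^{n+1}$ of the left series.
\<close>

primrec left_series :: "('a, 'b) ring_scheme \<Rightarrow> nat \<Rightarrow> 'a set"
  where
    "left_series X 0 = carrier X"
  | "left_series X (Suc n) = brace_set_star X (carrier X) (left_series X n)"

definition left_nilpotent :: "('a, 'b) ring_scheme \<Rightarrow> bool"
  where "left_nilpotent X \<longleftrightarrow> (\<exists>n. left_series X n = {\<zero>\<^bsub>X\<^esub>})"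

text \<open>
  For an ideal \<open>I\<close> of a skew brace \<open>X\<close>, the quotient \<open>X/I\<close> is the library's \<^term>\<open>X Quot I\<close>: its
  carrier consists of the additive cosets of \<open>I\<close> (which are also the multiplicative ones), and its
  operations are the ones induced by \<open>X\<close>; see \<open>quot_add\<close>, \<open>quot_mult\<close> below. The definition of
  \<^const>\<open>FactRing\<close> makes no use of commutativity or of ring axioms.
\<close>

definition left_nilpotent_residual :: "('a, 'b) ring_scheme \<Rightarrow> 'a set"
  where "left_nilpotent_residual X = \<Inter>{I. brace_ideal X I \<and> left_nilpotent (X Quot I)}"

definition p_part :: "nat \<Rightarrow> nat \<Rightarrow> nat"
  where "p_part p n = p ^ multiplicity p n"

definition sylow_subskew_brace :: "nat \<Rightarrow> ('a, 'b) ring_scheme \<Rightarrow> 'a set \<Rightarrow> bool"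
  where "sylow_subskew_brace p X P \<longleftrightarrow>
    subskew_brace X P \<and> card P = p_part p (card (carrier X))"

definition supplements :: "('a, 'b) ring_scheme \<Rightarrow> 'a set \<Rightarrow> 'a set \<Rightarrow> bool"
  where "supplements X C R \<longleftrightarrow> subskew_brace X C \<and> carrier X = R <+>\<^bsub>X\<^esub> C"

context skew_brace
begin

lemma zero_closed: "\<zero> \<in> carrier X"
  using additive.one_closed by simp

lemma add_closed: "\<lbrakk>x \<in> carrier X; y \<in> carrier X\<rbrakk> \<Longrightarrow> x \<oplus> y \<in> carrier X"
  using additive.m_closed[of x y] by simp

lemma minus_closed: "x \<in> carrier X \<Longrightarrow> \<ominus> x \<in> carrier X"
  using additive.inv_closed[of x] by (simp add: a_inv_def)

lemma add_minus_cancel: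
  assumes "x \<in> carrier X" "y \<in> carrier X"
  shows "x \<oplus> (\<ominus> x \<oplus> y) = y"
  using assms additive.inv_closed[of x] additive.m_assoc[of x "\<ominus> x" y]
    additive.r_inv[of x] additive.l_one[of y]
  by (simp add: a_inv_def)

lemma zero_eq_one: "\<zero> = \<one>"
proof -
  have "\<one> \<otimes> (\<zero> \<oplus> \<zero>) = (\<one> \<otimes> \<zero> \<ominus> \<one>) \<oplus> \<one> \<otimes> \<zero>"
    by (rule brace_distrib) (simp_all add: zero_closed)
  then have "\<zero> = \<ominus> \<one>"
    using additive.l_one[of "\<zero>"] additive.l_one[of "\<ominus> \<one>"] additive.r_one[of "\<ominus> \<one>"]
      zero_closed minus_closed[OF multiplicative.one_closed]
    by (simp add: a_minus_def)
  then show ?thesis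
    using add_minus_cancel[of "\<one>" "\<zero>"] additive.r_inv[of "\<one>"] additive.r_one[of "\<one>"]
    by (simp add: zero_closed a_inv_def)
qed

lemma a_coset_eq_coset:
  assumes I: "brace_ideal X I" and a: "a \<in> carrier X"
  shows "I +> a = I #> a"
proof -
  interpret A: normal I "add_monoid X"
    using I by (simp add: brace_ideal_def)
  interpret M: normal I X
    using I by (simp add: brace_ideal_def)
  have lam: "brace_lambda X c i \<in> I" if "c \<in> carrier X" "i \<in> I" for c i
    using I that by (auto simp: brace_ideal_def)
  have sub: "i \<in> carrier X" if "i \<in> I" for i
    using M.subset that by auto
  have "a <# I = a <#\<^bsub>add_monoid X\<^esub> I"
  proof (intro equalityI subsetI)
    fix x assume "x \<in> a <# I"
    then obtain i where i: "i \<in> I" "x = a \<otimes> i" by (auto simp: l_coset_def)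
    then have "x = a \<oplus> brace_lambda X a i"
      using a sub by (simp add: brace_lambda_def add_minus_cancel)
    then show "x \<in> a <#\<^bsub>add_monoid X\<^esub> I"
      using lam[OF a i(1)] by (auto simp: l_coset_def)
  next
    fix x assume "x \<in> a <#\<^bsub>add_monoid X\<^esub> I"
    then obtain i where i: "i \<in> I" "x = a \<oplus> i" by (auto simp: l_coset_def)
    let ?b = "inv a"
    have b: "?b \<in> carrier X" using a by simp
    have "?b \<otimes> x = (?b \<otimes> a \<ominus> ?b) \<oplus> ?b \<otimes> i"
      using i a b sub brace_distrib by simp
    also have "\<dots> = brace_lambda X ?b i"
      using a b additive.l_one[of "\<ominus> ?b"] minus_closed[OF b]
      by (simp add: brace_lambda_def a_minus_def zero_eq_one)
    finally have "?b \<otimes> x \<in> I" using lam[OF b i(1)] by simp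
    moreover have "x = a \<otimes> (?b \<otimes> x)"
      using a b i sub add_closed by (simp flip: multiplicative.m_assoc)
    ultimately show "x \<in> a <# I" by (auto simp: l_coset_def)
  qed
  then show ?thesis
    using A.coset_eq M.coset_eq a by (simp add: a_r_coset_def)
qed

lemma quot_add:
  assumes I: "brace_ideal X I" and a: "a \<in> carrier X" and b: "b \<in> carrier X"
  shows "(I +> a) \<oplus>\<^bsub>X Quot I\<^esub> (I +> b) = I +> (a \<oplus> b)"
proof -
  interpret A: normal I "add_monoid X"
    using I by (simp add: brace_ideal_def)
  show ?thesis
    using A.rcos_sum[of a b] a b by (simp add: FactRing_def set_add_def a_r_coset_def)
qed

lemma quot_mult:
  assumes I: "brace_ideal X I" and a: "a \<in> carrier X" and b: "b \<in> carrier X"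
  shows "(I +> a) \<otimes>\<^bsub>X Quot I\<^esub> (I +> b) = I +> (a \<otimes> b)"
proof -
  interpret M: normal I X
    using I by (simp add: brace_ideal_def)
  have eq: "I +> (x \<otimes> y) = I +> (a \<otimes> b)" if "x \<in> I +> a" "y \<in> I +> b" for x y
  proof -
    have x: "x \<in> I #> a" and y: "y \<in> I #> b"
      using that a_coset_eq_coset[OF I] a b by auto
    have xc: "x \<in> carrier X" and yc: "y \<in> carrier X"
      using x y a b M.subset multiplicative.r_coset_subset_G by blast+
    have "x \<otimes> y \<in> (I #> a) <#> (I #> b)"
      using x y by (auto simp: set_mult_def)
    then have "x \<otimes> y \<in> I #> (a \<otimes> b)"
      using M.rcos_sum[OF a b] by simp
    then have "I #> (x \<otimes> y) = I #> (a \<otimes> b)"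
      using multiplicative.repr_independence[OF _ _ M.subgroup_axioms] a b by auto
    then show ?thesis
      using a b xc yc a_coset_eq_coset[OF I] by simp
  qed
  have ne: "a \<in> I +> a" "b \<in> I +> b"
    using a b a_coset_eq_coset[OF I] multiplicative.rcos_self[OF _ M.subgroup_axioms] by auto
  have "(I +> a) \<otimes>\<^bsub>X Quot I\<^esub> (I +> b) = (\<Union>x\<in>I +> a. \<Union>y\<in>I +> b. I +> (x \<otimes> y))"
    by (simp add: FactRing_def rcoset_mult_def)
  also have "\<dots> = (\<Union>x\<in>I +> a. \<Union>y\<in>I +> b. I +> (a \<otimes> b))"
    by (intro SUP_cong refl) (simp add: eq)
  also have "\<dots> = I +> (a \<otimes> b)" using ne by auto
  finally show ?thesis .
qed

end

end

theory Submission
  imports Defs "HOL-Algebra.Zassenhaus" "HOL-Algebra.Left_Coset" "HOL-Algebra.Sylow"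
    "HOL-Number_Theory.Cong"
begin

text \<open>
  Write \<open>|X| = p\<^sup>a |R|\<close>. The residual \<open>R\<close> is a normal subgroup of the additive group, so for a
  subskew brace \<open>P\<close> of order \<open>|X|\<^sub>p\<close> the product formula \<open>|R + P| |R \<inter> P| = |R| |P|\<close>, together with
  \<open>|R \<inter> P| \<le> |R|\<^sub>p\<close>, leaves no room: \<open>R + P\<close> must be everything and \<open>R \<inter> P\<close> must have order \<open>|R|\<^sub>p\<close>
  (\<open>sylow_supplements_normal_of_prime_power_index\<close>).

  The left nilpotent supplement is such a \<open>P\<close>. Two facts are needed for this, and both rest on
  counting the fixed points of a \<open>p\<close>-group modulo \<open>p\<close> (\<open>p_group_fixed_points_cong\<close>).

  A Sylow \<open>p\<close>-subskew brace exists (\<open>exists_sylow_subskew_brace\<close>). A multiplicative Sylow subgroup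
  \<open>M\<close> fixes an additive Sylow subgroup \<open>A\<close> under \<open>\<lambda>\<close>, and then, acting by left multiplication, a coset
  \<open>x \<oplus> A\<close>. This forces \<open>M x = x \<oplus> A\<close>, and a translate of this set is a subgroup for both operations.

  A skew brace of prime power order is left nilpotent (\<open>left_nilpotent_of_prime_power_card\<close>). The
  multiplicative \<open>p\<close>-group acts by \<open>\<lambda>\<close> on the additive \<open>p\<close>-group, and every such action has a series of
  invariant normal subgroups with trivially acted factors; the left series descends at least as fast.
\<close>

section \<open>Fixed points of finite p-groups\<close>

text \<open>
  The library's group actions are homomorphisms into a group of extensional bijections. Here an
  action is given by its pointwise laws, which is how conjugation of subgroups, translation of
  cosets and \<open>\<lambda>\<close> on subsets present themselves; bijectivity follows from the inverse.
\<close>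

lemma group_action_restrictI:
  fixes G (structure)
  assumes "group G"
    and closed: "\<And>g x. \<lbrakk>g \<in> carrier G; x \<in> E\<rbrakk> \<Longrightarrow> \<phi> g x \<in> E"
    and one: "\<And>x. x \<in> E \<Longrightarrow> \<phi> \<one> x = x"
    and mult: "\<And>g h x. \<lbrakk>g \<in> carrier G; h \<in> carrier G; x \<in> E\<rbrakk> \<Longrightarrow> \<phi> (g \<otimes> h) x = \<phi> g (\<phi> h x)"
  shows "group_action G E (\<lambda>g. restrict (\<phi> g) E)"
proof -
  interpret group G by fact
  have bij: "restrict (\<phi> g) E \<in> Bij E" if g: "g \<in> carrier G" for g
  proof -
    have "\<phi> (inv g) (\<phi> g x) = x" "\<phi> g (\<phi> (inv g) x) = x" if "x \<in> E" for x
      using mult[of "inv g" g x] mult[of g "inv g" x] one that g by auto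
    then have "bij_betw (\<phi> g) E E"
      using closed g by (intro bij_betw_byWitness[where f' = "\<phi> (inv g)"]) auto
    then show ?thesis by (simp add: Bij_def)
  qed
  show ?thesis
    unfolding group_action_def group_hom_def group_hom_axioms_def
  proof (intro conjI homI)
    fix g h assume "g \<in> carrier G" "h \<in> carrier G"
    then show "restrict (\<phi> (g \<otimes> h)) E
        = restrict (\<phi> g) E \<otimes>\<^bsub>BijGroup E\<^esub> restrict (\<phi> h) E"
      using bij closed mult by (auto simp: BijGroup_def compose_def)
  qed (use bij in \<open>auto simp: BijGroup_def group_BijGroup[unfolded BijGroup_def] is_group\<close>)
qed

text \<open>
  The points that are not fixed form orbits whose lengths are nontrivial powers of \<open>p\<close>.
\<close>

lemma p_group_fixed_points_cong:
  fixes G (structure)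
  assumes G: "group G" and p: "prime p" and ord: "order G = p ^ k" and fin: "finite E"
    and closed: "\<And>g x. \<lbrakk>g \<in> carrier G; x \<in> E\<rbrakk> \<Longrightarrow> \<phi> g x \<in> E"
    and one: "\<And>x. x \<in> E \<Longrightarrow> \<phi> \<one> x = x"
    and mult: "\<And>g h x. \<lbrakk>g \<in> carrier G; h \<in> carrier G; x \<in> E\<rbrakk> \<Longrightarrow> \<phi> (g \<otimes> h) x = \<phi> g (\<phi> h x)"
  shows "[card {x \<in> E. \<forall>g\<in>carrier G. \<phi> g x = x} = card E] (mod p)"
proof -
  interpret group G by fact
  let ?\<phi> = "\<lambda>g. restrict (\<phi> g) E" and ?F = "{x \<in> E. \<forall>g\<in>carrier G. \<phi> g x = x}"
  interpret A: group_action G E ?\<phi>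
    using G closed one mult by (rule group_action_restrictI)
  have orb: "orbit G ?\<phi> x = {\<phi> g x | g. g \<in> carrier G}" if "x \<in> E" for x
    using that by (simp add: orbit_def)
  have self: "x \<in> orbit G ?\<phi> x" if "x \<in> E" for x
    using that by (rule A.orbit_refl)
  have part: "partition E (orbits G E ?\<phi>)"
    by (rule A.orbit_partition)
  have un: "\<Union>(orbits G E ?\<phi>) = E"
    by (rule partition.partition_coverture[OF part])
  define L where "L = {c \<in> orbits G E ?\<phi>. card c \<noteq> 1}"
  have L: "\<Union>L = E - ?F"
  proof (intro equalityI subsetI)
    fix x assume "x \<in> \<Union>L"
    then obtain y where y: "y \<in> E" "x \<in> orbit G ?\<phi> y" "card (orbit G ?\<phi> y) \<noteq> 1"
      by (auto simp: L_def orbits_def)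
    have x: "x \<in> E"
      using y closed orb by auto
    have "orbit G ?\<phi> x \<in> orbits G E ?\<phi>" "orbit G ?\<phi> y \<in> orbits G E ?\<phi>"
      using x y(1) by (auto simp: orbits_def)
    then have "orbit G ?\<phi> x = orbit G ?\<phi> y"
      using partition.unique_class[OF part x] y(2) self[OF x] by blast
    moreover have "orbit G ?\<phi> x = {x}" if "x \<in> ?F"
    proof -
      have "orbit G ?\<phi> x \<subseteq> {x}"
        using that unfolding orb[OF x] by auto
      then show ?thesis using self[OF x] by auto
    qed
    ultimately have "x \<notin> ?F"
      using y(3) by (metis is_singletonI is_singleton_altdef)
    then show "x \<in> E - ?F"
      using x by blast
  next
    fix x assume x: "x \<in> E - ?F"
    then obtain g where g: "g \<in> carrier G" "\<phi> g x \<noteq> x" by auto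
    have "\<phi> g x \<in> orbit G ?\<phi> x"
      using g x orb by auto
    then have "card (orbit G ?\<phi> x) \<noteq> 1"
      using g self[of x] x by (auto simp: card_1_singleton_iff)
    then show "x \<in> \<Union>L"
      using x self[of x] by (auto simp: L_def orbits_def)
  qed
  have finO: "finite c" if "c \<in> L" for c
    using that un fin by (intro finite_subset[of c E]) (auto simp: L_def)
  have "p dvd card c" if c: "c \<in> L" for c
  proof -
    from c obtain x where x: "x \<in> E" "c = orbit G ?\<phi> x" "card c \<noteq> 1"
      by (auto simp: L_def orbits_def)
    have "card c dvd p ^ k"
      unfolding x(2) ord[symmetric] A.orbit_stabilizer_theorem[OF x(1), symmetric] by simp
    then obtain i where "card c = p ^ i"
      using divides_primepow_nat[OF p] by blast
    then show ?thesis
      using x(3) by (cases i) auto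
  qed
  moreover have "pairwise disjnt L"
  proof (rule pairwiseI, unfold disjnt_def)
    fix c d assume cd: "c \<in> L" "d \<in> L" "c \<noteq> d"
    show "c \<inter> d = {}"
    proof (rule ccontr)
      assume "c \<inter> d \<noteq> {}"
      then obtain x where x: "x \<in> c" "x \<in> d" by blast
      then have "x \<in> E" using cd un by (auto simp: L_def)
      then show False
        using partition.unique_class[OF part] x cd unfolding L_def by blast
    qed
  qed
  ultimately have "p dvd card (\<Union>L)"
    using finO by (subst card_Union_disjoint) (auto intro: dvd_sum)
  then have "p dvd card E - card ?F"
    using L fin by (simp add: card_Diff_subset)
  then have "[card E = card ?F] (mod p)"
    using fin by (simp add: cong_altdef_nat card_mono)
  then show ?thesis by (rule cong_sym)
qed

corollary p_group_fixed_point_exists: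
  fixes G (structure)
  assumes "group G" "prime p" "order G = p ^ k" "finite E" and E: "\<not> p dvd card E"
    and "\<And>g x. \<lbrakk>g \<in> carrier G; x \<in> E\<rbrakk> \<Longrightarrow> \<phi> g x \<in> E"
    and "\<And>x. x \<in> E \<Longrightarrow> \<phi> \<one> x = x"
    and "\<And>g h x. \<lbrakk>g \<in> carrier G; h \<in> carrier G; x \<in> E\<rbrakk> \<Longrightarrow> \<phi> (g \<otimes> h) x = \<phi> g (\<phi> h x)"
  obtains x where "x \<in> E" "\<And>g. g \<in> carrier G \<Longrightarrow> \<phi> g x = x"
proof -
  let ?F = "{x \<in> E. \<forall>g\<in>carrier G. \<phi> g x = x}"
  have "[card ?F = card E] (mod p)"
    using assms(1-4,6-8) by (rule p_group_fixed_points_cong)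
  then have "card ?F \<noteq> 0"
    using E by (intro notI) (simp add: cong_def mod_eq_0_iff_dvd)
  then obtain x where "x \<in> ?F"
    by (metis (lifting) card.empty ex_in_conv)
  then show thesis
    using that by blast
qed

section \<open>Orders of subgroups and the number of Sylow subgroups\<close>

context group
begin

lemma card_subgroup_dvd_card:
  assumes H: "subgroup H G" and K: "subgroup K G" and "H \<subseteq> K"
  shows "card H dvd card K"
proof -
  interpret K: group "G\<lparr>carrier := K\<rparr>"
    using K by (rule subgroup_imp_group)
  have "card (rcosets\<^bsub>G\<lparr>carrier := K\<rparr>\<^esub> H) * card H = card K"
    using K.lagrange[OF subgroup_incl[OF assms]] by (simp add: order_def)
  then show ?thesis
    by (metis dvd_triv_right)
qed

text \<open>
  Each \<open>x\<close> in \<open>H K\<close> gets a chosen factorization \<open>x = f x \<otimes> g x\<close>; all others are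
  \<open>(f x \<otimes> d) \<otimes> (inv d \<otimes> g x)\<close> with \<open>d\<close> in \<open>H \<inter> K\<close>. So \<open>H \<times> K\<close> is in bijection with
  \<open>(H K) \<times> (H \<inter> K)\<close>.
\<close>

lemma card_set_mult_mult_card_Int:
  assumes H: "subgroup H G" and K: "subgroup K G"
  shows "card (H <#> K) * card (H \<inter> K) = card H * card K"
proof -
  interpret H: subgroup H G by fact
  interpret K: subgroup K G by fact
  have "\<forall>x\<in>H <#> K. \<exists>h k. h \<in> H \<and> k \<in> K \<and> x = h \<otimes> k"
    by (auto simp: set_mult_def)
  then obtain f g where fg: "f x \<in> H" "g x \<in> K" "f x \<otimes> g x = x" if "x \<in> H <#> K" for x
    by metis
  let ?F = "\<lambda>(x, d). (f x \<otimes> d, inv d \<otimes> g x)"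
  let ?B = "\<lambda>(h, k). (h \<otimes> k, inv (f (h \<otimes> k)) \<otimes> h)"
  have "bij_betw ?F ((H <#> K) \<times> (H \<inter> K)) (H \<times> K)"
  proof (rule bij_betw_byWitness[where f' = ?B])
    have prod: "f x \<otimes> d \<otimes> (inv d \<otimes> g x) = x" if "x \<in> H <#> K" "d \<in> H \<inter> K" for x d
    proof -
      have c: "f x \<in> carrier G" "g x \<in> carrier G" "d \<in> carrier G"
        using fg[OF that(1)] that(2) by auto
      have "f x \<otimes> d \<otimes> (inv d \<otimes> g x) = f x \<otimes> (d \<otimes> inv d) \<otimes> g x"
        using c by (simp only: m_assoc m_closed inv_closed)
      also have "\<dots> = f x \<otimes> g x"
        using c by simp
      finally show ?thesis using fg that by simp
    qed
    show "\<forall>a\<in>(H <#> K) \<times> (H \<inter> K). ?B (?F a) = a"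
    proof clarsimp
      fix x d assume x: "x \<in> H <#> K" and d: "d \<in> H" "d \<in> K"
      have c: "f x \<in> carrier G" "d \<in> carrier G"
        using fg[OF x] d by auto
      have "inv (f x) \<otimes> (f x \<otimes> d) = d"
        using c by (simp flip: m_assoc)
      then show "f x \<otimes> d \<otimes> (inv d \<otimes> g x) = x
          \<and> inv (f (f x \<otimes> d \<otimes> (inv d \<otimes> g x))) \<otimes> (f x \<otimes> d) = d"
        using prod[OF x] d by simp
    qed
    have mem: "h \<otimes> k \<in> H <#> K" if "h \<in> H" "k \<in> K" for h k
      using that by (auto simp: set_mult_def)
    show "\<forall>a\<in>H \<times> K. ?F (?B a) = a"
    proof clarsimp
      fix h k assume hk: "h \<in> H" "k \<in> K"
      let ?x = "h \<otimes> k"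
      have c: "h \<in> carrier G" "k \<in> carrier G" "f ?x \<in> carrier G" "g ?x \<in> carrier G"
        using hk fg[OF mem[OF hk]] by auto
      have "inv (inv (f ?x) \<otimes> h) \<otimes> g ?x = inv h \<otimes> (f ?x \<otimes> g ?x)"
        using c by (simp add: inv_mult_group m_assoc)
      also have "\<dots> = k"
        using fg(3)[OF mem[OF hk]] c by (simp flip: m_assoc)
      finally show "f ?x \<otimes> (inv (f ?x) \<otimes> h) = h \<and> inv (inv (f ?x) \<otimes> h) \<otimes> g ?x = k"
        using c by (simp flip: m_assoc)
    qed
    show "?F ` ((H <#> K) \<times> (H \<inter> K)) \<subseteq> H \<times> K"
      using fg by auto
    show "?B ` (H \<times> K) \<subseteq> (H <#> K) \<times> (H \<inter> K)"
    proof clarsimp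
      fix h k assume hk: "h \<in> H" "k \<in> K"
      let ?x = "h \<otimes> k"
      have c: "h \<in> carrier G" "k \<in> carrier G" "f ?x \<in> carrier G" "g ?x \<in> carrier G"
        using hk fg[OF mem[OF hk]] by auto
      have "inv (f ?x) \<otimes> (f ?x \<otimes> g ?x) = inv (f ?x) \<otimes> (h \<otimes> k)"
        using fg(3)[OF mem[OF hk]] by simp
      then have "g ?x = inv (f ?x) \<otimes> h \<otimes> k"
        using c by (simp flip: m_assoc)
      then have "inv (f ?x) \<otimes> h = g ?x \<otimes> inv k"
        using c by (simp add: m_assoc)
      then show "?x \<in> H <#> K \<and> inv (f ?x) \<otimes> h \<in> H \<and> inv (f ?x) \<otimes> h \<in> K"
        using mem[OF hk] H.m_closed[OF H.m_inv_closed[OF fg(1)[OF mem[OF hk]]] hk(1)]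
          K.m_closed[OF fg(2)[OF mem[OF hk]] K.m_inv_closed[OF hk(2)]]
        by simp
    qed
  qed
  then show ?thesis
    by (simp add: card_cartesian_product bij_betw_same_card flip: card_cartesian_product)
qed

text \<open>
  If a Sylow subgroup \<open>A\<close> normalizes the Sylow subgroup \<open>B\<close>, then \<open>B A\<close> is a subgroup whose order is
  a power of \<open>p\<close>, hence no larger than \<open>A\<close> and \<open>B\<close>.
\<close>

lemma sylow_normalized_eq:
  assumes fin: "finite (carrier G)" and p: "prime p"
    and A: "subgroup A G" "card A = p ^ multiplicity p (order G)"
    and B: "subgroup B G" "card B = p ^ multiplicity p (order G)"
    and norm: "\<And>a. a \<in> A \<Longrightarrow> a <# B #> inv a = B"
  shows "A = B"
proof -
  let ?N = "normalizer G B" and ?n = "multiplicity p (order G)"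
  have Bc: "B \<subseteq> carrier G" and Ac: "A \<subseteq> carrier G"
    using A B subgroup.subset by auto
  have N: "subgroup ?N G"
    using Bc by (rule normalizer_imp_subgroup)
  have AN: "A \<subseteq> ?N"
    using norm Ac Bc by (auto simp: normalizer_def stabilizer_def)
  interpret GN: group "G\<lparr>carrier := ?N\<rparr>"
    using N by (rule subgroup_imp_group)
  have "subgroup (B <#>\<^bsub>G\<lparr>carrier := ?N\<rparr>\<^esub> A) (G\<lparr>carrier := ?N\<rparr>)"
    using subgroup_in_normalizer[OF B(1)] subgroup_incl[OF A(1) N AN]
    by (rule GN.mult_norm_subgroup)
  then have BA: "subgroup (B <#> A) G"
    using incl_subgroup[OF N] by (simp add: set_mult_def)
  have prod: "card (B <#> A) * card (B \<inter> A) = p ^ (?n + ?n)"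
    using card_set_mult_mult_card_Int[OF B(1) A(1)] A B by (simp add: power_add)
  then have "card (B <#> A) dvd p ^ (?n + ?n)"
    by (intro dvdI[of _ _ "card (B \<inter> A)"]) simp
  then obtain i where i: "card (B <#> A) = p ^ i"
    using divides_primepow_nat[OF p] by blast
  have "p ^ i dvd order G"
    unfolding i[symmetric] lagrange[OF BA, symmetric] by (rule dvd_triv_right)
  then have "i \<le> ?n"
    using p fin order_gt_0_iff_finite by (intro multiplicity_geI) auto
  then have "p ^ i \<le> p ^ ?n"
    using prime_ge_1_nat[OF p] by (rule power_increasing)
  then have "p ^ i * card (B \<inter> A) \<le> p ^ ?n * card (B \<inter> A)"
    by (rule mult_le_mono1)
  then have "p ^ ?n * p ^ ?n \<le> p ^ ?n * card (B \<inter> A)"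
    unfolding prod[unfolded i power_add] .
  then have le: "p ^ ?n \<le> card (B \<inter> A)"
    using p by (simp add: prime_gt_0_nat)
  have "finite A" "finite B"
    using fin Ac Bc finite_subset by auto
  then have "B \<inter> A = B" "B \<inter> A = A"
    using card_seteq[OF _ Int_lower1 le[folded B(2)]] card_seteq[OF _ Int_lower2 le[folded A(2)]] by blast+
  then show ?thesis by simp
qed

text \<open>
  A Sylow subgroup \<open>A\<close> acts by conjugation on the set of all Sylow subgroups, and by the previous
  lemma \<open>A\<close> itself is the only fixed point.
\<close>

lemma card_sylow_subgroups_cong_1:
  assumes fin: "finite (carrier G)" and p: "prime p"
  shows "[card {S. subgroup S G \<and> card S = p ^ multiplicity p (order G)} = 1] (mod p)"
proof -
  let ?n = "multiplicity p (order G)"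
  let ?S = "{S. subgroup S G \<and> card S = p ^ ?n}"
  obtain m where m: "order G = p ^ ?n * m"
    using multiplicity_dvd[of p "order G"] by (elim dvdE)
  obtain A where A: "subgroup A G" "card A = p ^ ?n"
    using sylow_thm[OF p is_group m fin] by auto
  let ?c = "\<lambda>g S. g <# S #> inv g"
  have Ac: "a \<in> carrier G" if "a \<in> A" for a
    using A(1) that by (rule subgroup.mem_carrier)
  have sub: "S \<subseteq> carrier G" if "S \<in> ?S" for S
    using that by (auto dest: subgroup.subset)
  have "[card {S \<in> ?S. \<forall>g\<in>carrier (G\<lparr>carrier := A\<rparr>). ?c g S = S} = card ?S] (mod p)"
  proof (rule p_group_fixed_points_cong[where k = ?n])
    show "group (G\<lparr>carrier := A\<rparr>)" using A(1) by (rule subgroup_imp_group)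
    show "order (G\<lparr>carrier := A\<rparr>) = p ^ ?n" using A(2) by (simp add: order_def)
    show "finite ?S"
      using sub fin by (intro finite_subset[of ?S "Pow (carrier G)"]) auto
    show "?c g S \<in> ?S" if g: "g \<in> carrier (G\<lparr>carrier := A\<rparr>)" and S: "S \<in> ?S" for g S
    proof -
      have gc: "g \<in> carrier G" using g Ac by simp
      have "?c g S = (\<lambda>x. g \<otimes> x \<otimes> inv g) ` S"
        by (auto simp: l_coset_def r_coset_def)
      moreover have "inj_on (\<lambda>x. g \<otimes> x \<otimes> inv g) S"
        using gc sub[OF S] by (auto simp: inj_on_def subset_iff)
      ultimately have "card (?c g S) = card S"
        by (simp add: card_image)
      moreover have "subgroup (?c g S) G"
        using subgroup_conjugation_is_surj1[of "inv g" S] gc S by simp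
      ultimately show ?thesis using S by simp
    qed
    show "?c \<one>\<^bsub>G\<lparr>carrier := A\<rparr>\<^esub> S = S" if "S \<in> ?S" for S
      using sub[OF that] by (simp add: lcos_mult_one coset_mult_one)
    show "?c (g \<otimes>\<^bsub>G\<lparr>carrier := A\<rparr>\<^esub> h) S = ?c g (?c h S)"
      if gh: "g \<in> carrier (G\<lparr>carrier := A\<rparr>)" "h \<in> carrier (G\<lparr>carrier := A\<rparr>)" and S: "S \<in> ?S" for g h S
    proof -
      have c: "g \<in> carrier G" "h \<in> carrier G" using gh Ac by auto
      have img: "?c g S = (\<lambda>x. g \<otimes> x \<otimes> inv g) ` S" for g S
        by (auto simp: l_coset_def r_coset_def)
      have "(g \<otimes> h) \<otimes> x \<otimes> inv (g \<otimes> h) = g \<otimes> (h \<otimes> x \<otimes> inv h) \<otimes> inv g" if "x \<in> S" for x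
      proof -
        have "x \<in> carrier G" using that sub[OF S] by blast
        then show ?thesis using c by (simp add: inv_mult_group m_assoc)
      qed
      then have "?c (g \<otimes> h) S = ?c g (?c h S)"
        unfolding img image_image by (rule image_cong[OF refl])
      then show ?thesis by simp
    qed
  qed (rule p)
  also have "{S \<in> ?S. \<forall>g\<in>carrier (G\<lparr>carrier := A\<rparr>). ?c g S = S} = {A}"
  proof (intro equalityI subsetI)
    fix S assume "S \<in> {S \<in> ?S. \<forall>g\<in>carrier (G\<lparr>carrier := A\<rparr>). ?c g S = S}"
    then have "subgroup S G" "card S = p ^ ?n" "\<And>a. a \<in> A \<Longrightarrow> ?c a S = S"
      by auto
    then have "A = S"
      by (rule sylow_normalized_eq[OF fin p A])
    then show "S \<in> {A}" by simp
  next
    fix S assume "S \<in> {A}"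
    then have S: "S = A" by simp
    have "?c g A = A" if "g \<in> A" for g
      using that A(1) Ac[OF that]
      by (simp add: coset_join2 coset_join3 subgroup.m_inv_closed)
    then show "S \<in> {S \<in> ?S. \<forall>g\<in>carrier (G\<lparr>carrier := A\<rparr>). ?c g S = S}"
      using S A by simp
  qed
  finally show ?thesis by (simp add: cong_sym)
qed

end

section \<open>The action of the multiplicative group on the additive group\<close>

context skew_brace
begin

lemma add_assoc:
  "\<lbrakk>x \<in> carrier X; y \<in> carrier X; z \<in> carrier X\<rbrakk> \<Longrightarrow> (x \<oplus> y) \<oplus> z = x \<oplus> (y \<oplus> z)"
  using additive.m_assoc[of x y z] by simp

lemma minus_add_cancel:
  "\<lbrakk>x \<in> carrier X; y \<in> carrier X\<rbrakk> \<Longrightarrow> \<ominus> x \<oplus> (x \<oplus> y) = y"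
  using additive.inv_closed[of x] additive.m_assoc[of "\<ominus> x" x y] additive.l_inv[of x] additive.l_one[of y]
  by (simp add: a_inv_def)

lemma lambda_closed [simp]:
  "\<lbrakk>a \<in> carrier X; b \<in> carrier X\<rbrakk> \<Longrightarrow> brace_lambda X a b \<in> carrier X"
  by (simp add: brace_lambda_def add_closed minus_closed)

lemma mult_eq_add_lambda:
  "\<lbrakk>a \<in> carrier X; b \<in> carrier X\<rbrakk> \<Longrightarrow> a \<otimes> b = a \<oplus> brace_lambda X a b"
  by (simp add: brace_lambda_def add_minus_cancel)

lemma lambda_add:
  assumes "a \<in> carrier X" "b \<in> carrier X" "c \<in> carrier X"
  shows "brace_lambda X a (b \<oplus> c) = brace_lambda X a b \<oplus> brace_lambda X a c"
  using assms
  by (simp add: brace_lambda_def brace_distrib a_minus_def add_assoc add_closed minus_closed)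

lemma lambda_one:
  assumes "b \<in> carrier X" shows "brace_lambda X \<one> b = b"
  using minus_add_cancel[of "\<one>" b] additive.l_one[of b] assms
  by (simp add: brace_lambda_def zero_eq_one)

lemma lambda_mult:
  assumes a: "a \<in> carrier X" and b: "b \<in> carrier X" and c: "c \<in> carrier X"
  shows "brace_lambda X (a \<otimes> b) c = brace_lambda X a (brace_lambda X b c)"
proof -
  have "a \<otimes> b \<otimes> c = a \<otimes> (b \<oplus> brace_lambda X b c)"
    using assms by (simp add: multiplicative.m_assoc mult_eq_add_lambda[OF b c])
  also have "\<dots> = a \<oplus> brace_lambda X a (b \<oplus> brace_lambda X b c)"
    using assms by (simp add: mult_eq_add_lambda add_closed)
  also have "\<dots> = a \<otimes> b \<oplus> brace_lambda X a (brace_lambda X b c)"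
    using assms by (simp add: lambda_add mult_eq_add_lambda add_assoc)
  finally show ?thesis
    using assms minus_add_cancel[of "a \<otimes> b"] by (simp add: brace_lambda_def[of X "a \<otimes> b"])
qed

lemma lambda_group_hom:
  assumes "a \<in> carrier X"
  shows "group_hom (add_monoid X) (add_monoid X) (brace_lambda X a)"
  by unfold_locales (use assms in \<open>auto simp: hom_def lambda_add\<close>)

lemma lambda_inj_on:
  assumes a: "a \<in> carrier X"
  shows "inj_on (brace_lambda X a) (carrier X)"
proof (rule inj_on_inverseI)
  fix x assume "x \<in> carrier X"
  then show "brace_lambda X (inv a) (brace_lambda X a x) = x"
    using a lambda_mult[of "inv a" a x] lambda_one[of x] by simp
qed

text \<open>
  Left multiplication is affine over \<open>\<lambda>\<close>, that is \<open>a \<otimes> (x \<oplus> s) = (a \<otimes> x) \<oplus> \<lambda>\<^sub>a(s)\<close>. So it permutes the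
  additive left cosets of every \<open>\<lambda>\<close>-invariant subgroup.
\<close>

lemma mult_l_coset:
  assumes "a \<in> carrier X" "x \<in> carrier X" "S \<subseteq> carrier X"
  shows "(\<otimes>) a ` (x <#\<^bsub>add_monoid X\<^esub> S)
    = (a \<otimes> x) <#\<^bsub>add_monoid X\<^esub> (brace_lambda X a ` S)"
proof -
  have "a \<otimes> (x \<oplus> s) = a \<otimes> x \<oplus> brace_lambda X a s" if "s \<in> carrier X" for s
    using that assms
    by (simp add: mult_eq_add_lambda lambda_add add_closed add_assoc)
  then have "(\<lambda>s. a \<otimes> (x \<oplus> s)) ` S = (\<lambda>s. a \<otimes> x \<oplus> brace_lambda X a s) ` S"
    using assms(3) by (intro image_cong) auto
  moreover have "y <#\<^bsub>add_monoid X\<^esub> T = (\<oplus>) y ` T" for y T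
    by (auto simp: l_coset_def)
  ultimately show ?thesis by (simp add: image_image)
qed

lemma subskew_brace_imp_skew_brace:
  assumes C: "subskew_brace X C"
  shows "skew_brace (X\<lparr>carrier := C\<rparr>)"
proof -
  have A: "subgroup C (add_monoid X)" and M: "subgroup C X"
    using C by (auto simp: subskew_brace_def)
  have sub: "x \<in> carrier X" if "x \<in> C" for x
    using M that by (rule subgroup.mem_carrier)
  have "group (add_monoid (X\<lparr>carrier := C\<rparr>))"
    using additive.subgroup_imp_group[OF A] by simp
  moreover have "\<ominus>\<^bsub>X\<lparr>carrier := C\<rparr>\<^esub> x = \<ominus> x" if "x \<in> C" for x
    using additive.m_inv_consistent[OF A that] by (simp add: a_inv_def)
  ultimately show ?thesis
    using multiplicative.subgroup_imp_group[OF M] sub brace_distrib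
    unfolding skew_brace_def skew_brace_axioms_def a_minus_def by simp
qed

end

section \<open>Existence of Sylow subskew braces\<close>

context skew_brace
begin

text \<open>
  Let \<open>M\<close> be a Sylow \<open>p\<close>-subgroup of the multiplicative group. It acts by \<open>\<lambda>\<close> on the additive Sylow
  \<open>p\<close>-subgroups, whose number is prime to \<open>p\<close>, so it leaves one of them, \<open>A\<close>, invariant. By
  left multiplication it then acts on the additive cosets \<open>x \<oplus> A\<close>, whose number is again prime to
  \<open>p\<close>, so it leaves one of these invariant. Since \<open>x\<close> lies in it, \<open>M x\<close> is contained in \<open>x \<oplus> A\<close>, and
  equality of orders gives \<open>M x = x \<oplus> A\<close>. Multiplying by \<open>inv x\<close> on the left gives
  \<open>inv x M x = \<lambda>\<^bsub>inv x\<^esub>(A)\<close>: the left side is a subgroup of the multiplicative group, the right side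
  of the additive group.
\<close>

theorem exists_sylow_subskew_brace:
  assumes fin: "finite (carrier X)" and p: "prime p"
  shows "\<exists>P. sylow_subskew_brace p X P"
proof -
  let ?n = "multiplicity p (order X)" and ?A = "add_monoid X"
  let ?S = "{S. subgroup S ?A \<and> card S = p ^ ?n}"
  let ?l = "brace_lambda X"
  have ord: "order ?A = order X" and finA: "finite (carrier ?A)"
    using fin by (simp_all add: order_def)
  have pos: "order X > 0"
    using fin multiplicative.order_gt_0_iff_finite by blast
  obtain m where m: "order X = p ^ ?n * m"
    using multiplicity_dvd[of p "order X"] by (elim dvdE)
  have pm: "\<not> p dvd m"
  proof
    assume "p dvd m"
    then have "p ^ Suc ?n dvd order X"
      by (subst m) (auto simp: mult.commute intro: mult_dvd_mono)
    then show False
      using pos p by (metis Suc_n_not_le_n multiplicity_geI neq0_conv not_prime_unit)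
  qed
  obtain M where M: "subgroup M X" "card M = p ^ ?n"
    using sylow_thm[OF p multiplicative.is_group m fin] by auto
  have Mc: "a \<in> carrier X" if "a \<in> M" for a
    using M(1) that by (rule subgroup.mem_carrier)
  have Msub: "M \<subseteq> carrier X"
    using M(1) by (rule subgroup.subset)
  interpret M: group "X\<lparr>carrier := M\<rparr>"
    using M(1) by (rule multiplicative.subgroup_imp_group)
  have ordM: "order (X\<lparr>carrier := M\<rparr>) = p ^ ?n"
    using M(2) by (simp add: order_def)
  have Ssub: "S \<subseteq> carrier X" if "subgroup S ?A" for S
    using subgroup.subset[OF that] by simp
  have l_sub: "subgroup (?l a ` S) ?A" "card (?l a ` S) = card S"
    if "a \<in> carrier X" "subgroup S ?A" for a S
    using that group_hom.subgroup_img_is_subgroup[OF lambda_group_hom] Ssub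
    by (auto intro!: card_image inj_on_subset[OF lambda_inj_on])
  have "[card ?S = 1] (mod p)"
    using additive.card_sylow_subgroups_cong_1[OF finA p] unfolding ord .
  then have pS: "\<not> p dvd card ?S"
    using cong_dvd_iff[of "card ?S" 1 p] p by (auto dest: not_prime_unit)
  obtain A where "A \<in> ?S" and A_fixed: "\<And>a. a \<in> carrier (X\<lparr>carrier := M\<rparr>) \<Longrightarrow> ?l a ` A = A"
  proof (rule p_group_fixed_point_exists[OF M.is_group p ordM _ pS, where \<phi> = "\<lambda>a S. ?l a ` S"])
    show "finite ?S"
      using Ssub fin by (intro finite_subset[of ?S "Pow (carrier X)"]) auto
    show "?l a ` S \<in> ?S" if "a \<in> carrier (X\<lparr>carrier := M\<rparr>)" "S \<in> ?S" for a S
      using that l_sub Mc by simp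
    show "?l \<one>\<^bsub>X\<lparr>carrier := M\<rparr>\<^esub> ` S = S" if "S \<in> ?S" for S
      using that Ssub lambda_one by (force simp: subset_iff)
    show "?l (a \<otimes>\<^bsub>X\<lparr>carrier := M\<rparr>\<^esub> b) ` S = ?l a ` ?l b ` S"
      if "a \<in> carrier (X\<lparr>carrier := M\<rparr>)" "b \<in> carrier (X\<lparr>carrier := M\<rparr>)" "S \<in> ?S" for a b S
      using that Ssub[of S] lambda_mult Mc unfolding image_image
      by (intro image_cong) (auto simp: subset_iff)
  qed blast
  then have A: "subgroup A ?A" "card A = p ^ ?n" "\<And>a. a \<in> M \<Longrightarrow> ?l a ` A = A"
    by auto
  let ?E = "lcosets\<^bsub>?A\<^esub> A"
  have E: "c \<in> ?E \<longleftrightarrow> (\<exists>x\<in>carrier X. c = x <#\<^bsub>?A\<^esub> A)" for c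
    by (auto simp: LCOSETS_def)
  have "card ?E * p ^ ?n = p ^ ?n * m"
    using additive.l_lagrange[OF finA A(1)] A(2) m ord by simp
  then have cardE: "card ?E = m"
    using p by (simp add: prime_gt_0_nat)
  have Ec: "c \<subseteq> carrier X" if "c \<in> ?E" for c
    using that additive.lcosets_subset_PowG[OF A(1)] by auto
  obtain c where "c \<in> ?E" "\<And>a. a \<in> carrier (X\<lparr>carrier := M\<rparr>) \<Longrightarrow> (\<otimes>) a ` c = c"
  proof (rule p_group_fixed_point_exists[OF M.is_group p ordM _ pm[folded cardE],
        where \<phi> = "\<lambda>a c. (\<otimes>) a ` c"])
    show "finite ?E"
      using Ec fin by (intro finite_subset[of ?E "Pow (carrier X)"]) auto
    show "(\<otimes>) a ` c \<in> ?E" if a: "a \<in> carrier (X\<lparr>carrier := M\<rparr>)" and c: "c \<in> ?E" for a c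
    proof -
      obtain x where x: "x \<in> carrier X" "c = x <#\<^bsub>?A\<^esub> A"
        using c E by auto
      have "(\<otimes>) a ` c = (a \<otimes> x) <#\<^bsub>?A\<^esub> A"
        using mult_l_coset[of a x A] x a Mc A Ssub by simp
      then show ?thesis
        using E x a Mc by auto
    qed
    show "(\<otimes>) \<one>\<^bsub>X\<lparr>carrier := M\<rparr>\<^esub> ` c = c" if "c \<in> ?E" for c
      using Ec[OF that] by (force simp: subset_iff)
    show "(\<otimes>) (a \<otimes>\<^bsub>X\<lparr>carrier := M\<rparr>\<^esub> b) ` c = (\<otimes>) a ` (\<otimes>) b ` c"
      if "a \<in> carrier (X\<lparr>carrier := M\<rparr>)" "b \<in> carrier (X\<lparr>carrier := M\<rparr>)" "c \<in> ?E" for a b c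
      using that Ec[of c] Mc unfolding image_image
      by (intro image_cong) (auto simp: subset_iff multiplicative.m_assoc)
  qed blast
  then obtain x where x: "x \<in> carrier X"
    and fixed: "\<And>a. a \<in> M \<Longrightarrow> (\<otimes>) a ` (x <#\<^bsub>?A\<^esub> A) = x <#\<^bsub>?A\<^esub> A"
    using E by auto
  let ?xA = "x <#\<^bsub>?A\<^esub> A"
  have xA: "?xA = (\<oplus>) x ` A"
    by (auto simp: l_coset_def)
  have finA': "finite A"
    using Ssub[OF A(1)] fin finite_subset by blast
  have "x \<in> ?xA"
    using additive.lcos_self[of x A] x A(1) by simp
  then have sub: "M #> x \<subseteq> ?xA"
    using fixed by (fastforce simp: r_coset_def)
  have "card (M #> x) = card M"
    using multiplicative.card_rcosets_equal[OF multiplicative.rcosetsI[OF Msub x] Msub] by simp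
  moreover have "card ?xA \<le> card A"
    unfolding xA using finA' by (rule card_image_le)
  moreover have "finite ?xA"
    unfolding xA using finA' by simp
  ultimately have Mx: "M #> x = ?xA"
    using sub A(2) M(2) by (intro card_seteq) auto
  have "inv x <# M #> x = inv x <# (M #> x)"
    using x Msub by (simp add: multiplicative.coset_assoc)
  also have "\<dots> = (\<otimes>) (inv x) ` ?xA"
    unfolding Mx by (auto simp: l_coset_def)
  also have "\<dots> = ?l (inv x) ` A"
  proof -
    have "\<one> <#\<^bsub>?A\<^esub> (?l (inv x) ` A) = ?l (inv x) ` A"
    proof -
      have "?l (inv x) ` A \<subseteq> carrier X"
        using x Ssub[OF A(1)] by (auto simp: subset_iff)
      then show ?thesis
        using additive.lcos_mult_one[of "?l (inv x) ` A"] by (simp add: zero_eq_one)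
    qed
    then show ?thesis
      using mult_l_coset[of "inv x" x A] x Ssub[OF A(1)] by simp
  qed
  finally have eq: "inv x <# M #> x = ?l (inv x) ` A" .
  have "subgroup (?l (inv x) ` A) X"
    using multiplicative.subgroup_conjugation_is_surj1[OF x M(1)] unfolding eq .
  then have "sylow_subskew_brace p X (?l (inv x) ` A)"
    using l_sub[of "inv x" A] x A
    by (simp add: sylow_subskew_brace_def subskew_brace_def p_part_def order_def)
  then show ?thesis ..
qed

end

section \<open>Actions of p-groups on p-groups\<close>

context group
begin

text \<open>
  The centre is the fixed-point set of conjugation, so \<open>p\<close> divides its order; \<open>K\<close> permutes the
  centre, so \<open>p\<close> divides the number of its fixed points there, and one of them is not \<open>\<one>\<close>.
\<close>

lemma exists_central_fixed_point:
  fixes K (structure)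
  assumes fin: "finite (carrier G)" and p: "prime p" and dvd: "p dvd order G" and ordG: "order G = p ^ n"
    and K: "group K" "order K = p ^ k"
    and hom: "\<And>a. a \<in> carrier K \<Longrightarrow> \<phi> a \<in> hom G G"
    and one: "\<And>x. x \<in> carrier G \<Longrightarrow> \<phi> \<one>\<^bsub>K\<^esub> x = x"
    and mult: "\<And>a b x. \<lbrakk>a \<in> carrier K; b \<in> carrier K; x \<in> carrier G\<rbrakk>
      \<Longrightarrow> \<phi> (a \<otimes>\<^bsub>K\<^esub> b) x = \<phi> a (\<phi> b x)"
  obtains z where "z \<in> carrier G" "z \<noteq> \<one>\<^bsub>G\<^esub>"
    "\<And>y. y \<in> carrier G \<Longrightarrow> y \<otimes>\<^bsub>G\<^esub> z = z \<otimes>\<^bsub>G\<^esub> y"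
    "\<And>a. a \<in> carrier K \<Longrightarrow> \<phi> a z = z"
proof -
  interpret K: group K by fact
  let ?Z = "{x \<in> carrier G. \<forall>g\<in>carrier G. g \<otimes>\<^bsub>G\<^esub> x \<otimes>\<^bsub>G\<^esub> inv\<^bsub>G\<^esub> g = x}"
  have Z: "x \<in> ?Z \<longleftrightarrow> x \<in> carrier G \<and> (\<forall>g\<in>carrier G. g \<otimes>\<^bsub>G\<^esub> x = x \<otimes>\<^bsub>G\<^esub> g)" for x
  proof -
    have "g \<otimes>\<^bsub>G\<^esub> x \<otimes>\<^bsub>G\<^esub> inv\<^bsub>G\<^esub> g = x \<longleftrightarrow> g \<otimes>\<^bsub>G\<^esub> x = x \<otimes>\<^bsub>G\<^esub> g"
      if "x \<in> carrier G" "g \<in> carrier G" for g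
      by (rule inv_solve_right') (use that in simp_all)
    then show ?thesis by auto
  qed
  have closed: "\<phi> a x \<in> carrier G" if "a \<in> carrier K" "x \<in> carrier G" for a x
    using hom_in_carrier[OF hom] that by blast
  have "[card ?Z = card (carrier G)] (mod p)"
    by (rule p_group_fixed_points_cong[OF is_group p ordG fin])
      (simp_all add: inv_mult_group m_assoc)
  then have "p dvd card ?Z"
    using dvd cong_dvd_iff unfolding order_def by blast
  let ?F = "{x \<in> ?Z. \<forall>a\<in>carrier K. \<phi> a x = x}"
  have "[card ?F = card ?Z] (mod p)"
  proof (rule p_group_fixed_points_cong[OF K(1) p K(2)])
    show "\<phi> a x \<in> ?Z" if a: "a \<in> carrier K" and x: "x \<in> ?Z" for a x
    proof -
      have "g \<otimes>\<^bsub>G\<^esub> \<phi> a x = \<phi> a x \<otimes>\<^bsub>G\<^esub> g" if g: "g \<in> carrier G" for g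
      proof -
        \<comment> \<open>Every \<open>g\<close> lies in the image of the automorphism \<open>\<phi> a\<close>, so it is enough to commute with \<open>\<phi> a h\<close>.\<close>
        define h where "h = \<phi> (inv\<^bsub>K\<^esub> a) g"
        have h: "h \<in> carrier G" "g = \<phi> a h"
          unfolding h_def using a g closed mult[of a "inv\<^bsub>K\<^esub> a" g] one by simp_all
        have "h \<otimes>\<^bsub>G\<^esub> x = x \<otimes>\<^bsub>G\<^esub> h" "x \<in> carrier G"
          using x h Z by auto
        then show ?thesis
          unfolding h(2) using hom_mult[OF hom[OF a]] h(1) by metis
      qed
      then show ?thesis
        using Z closed a x by blast
    qed
  qed (use fin one mult in auto)
  then have dvdF: "p dvd card ?F"
    using \<open>p dvd card ?Z\<close> cong_dvd_iff by blast
  have "\<one>\<^bsub>G\<^esub> \<in> ?F"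
    using hom_one[OF hom is_group is_group] by simp
  moreover have "?F \<noteq> {\<one>\<^bsub>G\<^esub>}"
  proof
    assume "?F = {\<one>\<^bsub>G\<^esub>}"
    then have "card ?F = 1" by (simp only: card.insert_remove) simp
    then show False using dvdF p by (metis not_prime_unit)
  qed
  ultimately obtain z where z: "z \<in> ?F" "z \<noteq> \<one>\<^bsub>G\<^esub>" by blast
  have "z \<in> ?Z" using z(1) by blast
  then show thesis
    using that[of z] z Z by blast
qed

text \<open>
  One step of an ascending series on which \<open>K\<close> acts trivially factor by factor: \<open>N'\<close> is the preimage
  of the elements of \<open>G/N\<close> that are central and fixed by \<open>K\<close>, and these are not only the neutral
  element by the previous lemma. Both conditions say that an endomorphism of \<open>G\<close> (an inner one, or
  one of the \<open>\<phi> a\<close>) moves \<open>x\<close> only within its coset modulo \<open>N\<close>, so they are treated together.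
\<close>

lemma exists_larger_normal_subgroup_fixed_mod:
  fixes K (structure)
  assumes fin: "finite (carrier G)" and p: "prime p" and ordG: "order G = p ^ n"
    and K: "group K" "order K = p ^ k"
    and hom: "\<And>a. a \<in> carrier K \<Longrightarrow> \<phi> a \<in> hom G G"
    and one: "\<And>x. x \<in> carrier G \<Longrightarrow> \<phi> \<one>\<^bsub>K\<^esub> x = x"
    and mult: "\<And>a b x. \<lbrakk>a \<in> carrier K; b \<in> carrier K; x \<in> carrier G\<rbrakk>
      \<Longrightarrow> \<phi> (a \<otimes>\<^bsub>K\<^esub> b) x = \<phi> a (\<phi> b x)"
    and N: "N \<lhd> G" "N \<noteq> carrier G" and inv: "\<And>a x. \<lbrakk>a \<in> carrier K; x \<in> N\<rbrakk> \<Longrightarrow> \<phi> a x \<in> N"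
  obtains N' where "N' \<lhd> G" "N \<subset> N'"
    "\<And>a x. \<lbrakk>a \<in> carrier K; x \<in> N'\<rbrakk> \<Longrightarrow> \<phi> a x \<otimes>\<^bsub>G\<^esub> inv\<^bsub>G\<^esub> x \<in> N"
proof -
  interpret K: group K by fact
  interpret N: normal N G by fact
  let ?\<pi> = "\<lambda>x. N #>\<^bsub>G\<^esub> x"
  \<comment> \<open>The quotient is kept opaque, so that its product is not rewritten to products of subsets.\<close>
  define F where "F = G Mod N"
  interpret F: group F
    unfolding F_def by (rule N.factorgroup_is_group)
  interpret \<pi>: group_hom G F ?\<pi>
    by unfold_locales (simp only: F_def N.r_coset_hom_Mod)
  have Fc: "c \<in> carrier F \<longleftrightarrow> (\<exists>x\<in>carrier G. c = ?\<pi> x)" for c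
    by (auto simp: F_def carrier_FactGroup)
  have closed: "\<phi> a x \<in> carrier G" if "a \<in> carrier K" "x \<in> carrier G" for a x
    using hom_in_carrier[OF hom] that by blast
  have \<phi>_mult: "\<phi> a (x \<otimes>\<^bsub>G\<^esub> y) = \<phi> a x \<otimes>\<^bsub>G\<^esub> \<phi> a y"
    if "a \<in> carrier K" "x \<in> carrier G" "y \<in> carrier G" for a x y
    using hom_mult[OF hom] that by blast
  have \<pi>_eq: "?\<pi> x = ?\<pi> y \<longleftrightarrow> x \<otimes>\<^bsub>G\<^esub> inv\<^bsub>G\<^esub> y \<in> N"
    if "x \<in> carrier G" "y \<in> carrier G" for x y
  proof -
    have "?\<pi> x = ?\<pi> y \<longleftrightarrow> x \<in> ?\<pi> y"
      using that N.subgroup_axioms rcos_self repr_independence by metis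
    also have "\<dots> \<longleftrightarrow> x \<otimes>\<^bsub>G\<^esub> inv\<^bsub>G\<^esub> y \<in> N"
      using N.rcos_module[OF is_group] that by blast
    finally show ?thesis .
  qed
  have \<phi>_coset: "\<phi> a ` ?\<pi> x = ?\<pi> (\<phi> a x)" if a: "a \<in> carrier K" and x: "x \<in> carrier G" for a x
  proof (intro equalityI subsetI)
    fix y assume "y \<in> \<phi> a ` ?\<pi> x"
    then obtain n where "n \<in> N" "y = \<phi> a (n \<otimes>\<^bsub>G\<^esub> x)"
      by (auto simp: r_coset_def)
    then show "y \<in> ?\<pi> (\<phi> a x)"
      using a x inv[of a n] \<phi>_mult by (auto simp: r_coset_def)
  next
    fix y assume "y \<in> ?\<pi> (\<phi> a x)"
    then obtain n where n: "n \<in> N" "y = n \<otimes>\<^bsub>G\<^esub> \<phi> a x"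
      by (auto simp: r_coset_def)
    let ?m = "\<phi> (inv\<^bsub>K\<^esub> a) n"
    have m: "?m \<in> N" using a n inv by simp
    have "n = \<phi> a ?m"
      using a n mult[of a "inv\<^bsub>K\<^esub> a" n] one by simp
    then have "y = \<phi> a (?m \<otimes>\<^bsub>G\<^esub> x)"
      using a x m n \<phi>_mult by simp
    then show "y \<in> \<phi> a ` ?\<pi> x"
      using m by (auto simp: r_coset_def)
  qed
  define E where "E = (\<lambda>g x. g \<otimes>\<^bsub>G\<^esub> x \<otimes>\<^bsub>G\<^esub> inv\<^bsub>G\<^esub> g) ` carrier G \<union> \<phi> ` carrier K"
  have E_hom: "group_hom G G f" if "f \<in> E" for f
  proof -
    have "(\<lambda>x. g \<otimes>\<^bsub>G\<^esub> x \<otimes>\<^bsub>G\<^esub> inv\<^bsub>G\<^esub> g) \<in> hom G G" if g: "g \<in> carrier G" for g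
    proof (rule homI)
      fix x y assume "x \<in> carrier G" "y \<in> carrier G"
      moreover have "inv\<^bsub>G\<^esub> g \<otimes>\<^bsub>G\<^esub> (g \<otimes>\<^bsub>G\<^esub> z) = z" if "z \<in> carrier G" for z
        using g that by (simp flip: m_assoc)
      ultimately show "g \<otimes>\<^bsub>G\<^esub> (x \<otimes>\<^bsub>G\<^esub> y) \<otimes>\<^bsub>G\<^esub> inv\<^bsub>G\<^esub> g
          = g \<otimes>\<^bsub>G\<^esub> x \<otimes>\<^bsub>G\<^esub> inv\<^bsub>G\<^esub> g \<otimes>\<^bsub>G\<^esub> (g \<otimes>\<^bsub>G\<^esub> y \<otimes>\<^bsub>G\<^esub> inv\<^bsub>G\<^esub> g)"
        using g by (simp add: m_assoc)
    qed (use g in simp)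
    then have "f \<in> hom G G"
      using that hom unfolding E_def by blast
    then show ?thesis
      by unfold_locales
  qed
  define N' where "N' = {x \<in> carrier G. \<forall>f\<in>E. ?\<pi> (f x) = ?\<pi> x}"
  have N'I: "x \<in> N'" if "x \<in> carrier G" "\<And>f. f \<in> E \<Longrightarrow> ?\<pi> (f x) = ?\<pi> x" for x
    using that by (simp add: N'_def)
  have N'_carrier: "x \<in> carrier G" if "x \<in> N'" for x
    using that by (simp add: N'_def)
  have N'D: "?\<pi> (f x) = ?\<pi> x" if "x \<in> N'" "f \<in> E" for x f
    using that by (simp add: N'_def)
  have N'_sub: "subgroup N' G"
  proof (rule subgroupI)
    have "?\<pi> (f \<one>\<^bsub>G\<^esub>) = ?\<pi> \<one>\<^bsub>G\<^esub>" if "f \<in> E" for f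
      by (simp only: group_hom.hom_one[OF E_hom[OF that]])
    then show "N' \<noteq> {}"
      using N'I[OF one_closed] by blast
    show "inv\<^bsub>G\<^esub> x \<in> N'" if x: "x \<in> N'" for x
    proof -
      have "?\<pi> (f (inv\<^bsub>G\<^esub> x)) = ?\<pi> (inv\<^bsub>G\<^esub> x)" if f: "f \<in> E" for f
      proof -
        interpret f: group_hom G G f using f by (rule E_hom)
        have "x \<in> carrier G" using x by (rule N'_carrier)
        then show ?thesis using N'D[OF x f] by (simp only: f.hom_inv \<pi>.hom_inv f.hom_closed)
      qed
      then show ?thesis using x N'I N'_carrier inv_closed by blast
    qed
    show "x \<otimes>\<^bsub>G\<^esub> y \<in> N'" if x: "x \<in> N'" and y: "y \<in> N'" for x y
    proof -
      have "?\<pi> (f (x \<otimes>\<^bsub>G\<^esub> y)) = ?\<pi> (x \<otimes>\<^bsub>G\<^esub> y)" if f: "f \<in> E" for f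
      proof -
        interpret f: group_hom G G f using f by (rule E_hom)
        have "x \<in> carrier G" "y \<in> carrier G"
          using x y N'_carrier by blast+
        then show ?thesis using N'D[OF x f] N'D[OF y f] by (simp only: f.hom_mult \<pi>.hom_mult f.hom_closed)
      qed
      then show ?thesis using x y N'I N'_carrier m_closed by blast
    qed
  qed (use N'_carrier in blast)
  interpret N': subgroup N' G by (rule N'_sub)
  have moved: "f x \<otimes>\<^bsub>G\<^esub> inv\<^bsub>G\<^esub> x \<in> N" if f: "f \<in> E" and x: "x \<in> N'" for f x
  proof -
    have "x \<in> carrier G" using x by (rule N'_carrier)
    then show ?thesis
      using N'D[OF x f] \<pi>_eq[of "f x" x] group_hom.hom_closed[OF E_hom[OF f]] by blast
  qed
  have N_sub: "N \<subseteq> N'"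
  proof
    fix x assume x: "x \<in> N"
    have "?\<pi> (f x) = ?\<pi> x" if "f \<in> E" for f
    proof -
      have "f x \<in> N"
        using that x inv N.inv_op_closed2 unfolding E_def by blast
      then have "f x \<otimes>\<^bsub>G\<^esub> inv\<^bsub>G\<^esub> x \<in> N"
        using x N.m_closed N.m_inv_closed by blast
      then show ?thesis
        using \<pi>_eq[OF N.mem_carrier[OF \<open>f x \<in> N\<close>] N.mem_carrier[OF x]] by blast
    qed
    then show "x \<in> N'"
      using N.mem_carrier[OF x] by (intro N'I)
  qed
  have normal: "N' \<lhd> G"
  proof (rule normal_invI[OF N'_sub])
    fix g x assume g: "g \<in> carrier G" and x: "x \<in> N'"
    let ?y = "g \<otimes>\<^bsub>G\<^esub> x \<otimes>\<^bsub>G\<^esub> inv\<^bsub>G\<^esub> g"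
    have xc: "x \<in> carrier G" using x by (rule N'_carrier)
    have "?y \<otimes>\<^bsub>G\<^esub> inv\<^bsub>G\<^esub> x \<in> N'"
      using moved[OF _ x] N_sub g unfolding E_def by blast
    then have "?y \<otimes>\<^bsub>G\<^esub> inv\<^bsub>G\<^esub> x \<otimes>\<^bsub>G\<^esub> x \<in> N'"
      using x by (rule N'.m_closed)
    moreover have "?y \<otimes>\<^bsub>G\<^esub> inv\<^bsub>G\<^esub> x \<otimes>\<^bsub>G\<^esub> x = ?y"
      using g xc by (simp add: m_assoc)
    ultimately show "?y \<in> N'" by (simp only:)
  qed
  have F_index: "order F * card N = p ^ n"
    using lagrange[OF N.subgroup_axioms] ordG by (simp add: F_def FactGroup_def order_def)
  then obtain i where i: "order F = p ^ i"
    using divides_primepow_nat[OF p, of "order F" n] dvdI[of "p ^ n" "order F" "card N"] by auto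
  have "order F \<noteq> 1"
  proof
    assume "order F = 1"
    then have "card N = card (carrier G)"
      using F_index ordG by (simp add: order_def)
    then show False
      using N(2) N.subset fin card_subset_eq by blast
  qed
  then have pF: "p dvd order F"
    using i by (cases i) auto
  have finF: "finite (carrier F)"
    using fin by (simp add: F_def carrier_FactGroup)
  obtain z where z: "z \<in> carrier F" "z \<noteq> \<one>\<^bsub>F\<^esub>"
    "\<And>y. y \<in> carrier F \<Longrightarrow> y \<otimes>\<^bsub>F\<^esub> z = z \<otimes>\<^bsub>F\<^esub> y"
    "\<And>a. a \<in> carrier K \<Longrightarrow> \<phi> a ` z = z"
  proof (rule F.exists_central_fixed_point[OF finF p pF i K, where \<phi> = "\<lambda>a c. \<phi> a ` c"])
    show "(`) (\<phi> a) \<in> hom F F" if a: "a \<in> carrier K" for a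
    proof (rule homI)
      show "\<phi> a ` c \<in> carrier F" if "c \<in> carrier F" for c
        using that \<phi>_coset closed a unfolding Fc by blast
      fix c d assume "c \<in> carrier F" "d \<in> carrier F"
      then obtain x y where xy: "x \<in> carrier G" "c = ?\<pi> x" "y \<in> carrier G" "d = ?\<pi> y"
        unfolding Fc by blast
      have "\<phi> a ` (c \<otimes>\<^bsub>F\<^esub> d) = \<phi> a ` ?\<pi> (x \<otimes>\<^bsub>G\<^esub> y)"
        using xy by simp
      also have "\<dots> = \<phi> a ` c \<otimes>\<^bsub>F\<^esub> \<phi> a ` d"
        using a xy \<phi>_coset[of a "x \<otimes>\<^bsub>G\<^esub> y"]
        by (simp add: \<phi>_coset \<phi>_mult closed del: \<pi>.hom_mult flip: \<pi>.hom_mult)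
      finally show "\<phi> a ` (c \<otimes>\<^bsub>F\<^esub> d) = \<phi> a ` c \<otimes>\<^bsub>F\<^esub> \<phi> a ` d" .
    qed
    show "\<phi> \<one>\<^bsub>K\<^esub> ` c = c" if "c \<in> carrier F" for c
    proof -
      from that[unfolded Fc] obtain x where x: "x \<in> carrier G" "c = ?\<pi> x" by (rule bexE)
      show ?thesis
        unfolding x(2) \<phi>_coset[OF K.one_closed x(1)] one[OF x(1)] by (rule refl)
    qed
    show "\<phi> (a \<otimes>\<^bsub>K\<^esub> b) ` c = \<phi> a ` \<phi> b ` c"
      if "a \<in> carrier K" "b \<in> carrier K" "c \<in> carrier F" for a b c
    proof -
      from that(3)[unfolded Fc] obtain x where x: "x \<in> carrier G" "c = ?\<pi> x" by (rule bexE)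
      show ?thesis
        unfolding x(2) \<phi>_coset[OF that(2) x(1)] \<phi>_coset[OF that(1) closed[OF that(2) x(1)]]
          \<phi>_coset[OF K.m_closed[OF that(1,2)] x(1)] mult[OF that(1,2) x(1)] by (rule refl)
    qed
  qed blast
  from z(1) obtain x where x: "x \<in> carrier G" "z = ?\<pi> x"
    unfolding Fc by blast
  have "x \<notin> N"
    using z(2) x coset_join2[OF _ N.subgroup_axioms] by (auto simp: F_def)
  moreover have "?\<pi> (f x) = ?\<pi> x" if "f \<in> E" for f
    using that unfolding E_def
  proof
    assume "f \<in> \<phi> ` carrier K"
    then show ?thesis
      using z(4) x \<phi>_coset by auto
  next
    assume "f \<in> (\<lambda>g x. g \<otimes>\<^bsub>G\<^esub> x \<otimes>\<^bsub>G\<^esub> inv\<^bsub>G\<^esub> g) ` carrier G"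
    then obtain g where g: "g \<in> carrier G" "f = (\<lambda>x. g \<otimes>\<^bsub>G\<^esub> x \<otimes>\<^bsub>G\<^esub> inv\<^bsub>G\<^esub> g)"
      by blast
    have "?\<pi> (f x) = ?\<pi> g \<otimes>\<^bsub>F\<^esub> z \<otimes>\<^bsub>F\<^esub> inv\<^bsub>F\<^esub> ?\<pi> g"
      using g x by simp
    also have "\<dots> = z"
      using z(1,3) g by (simp add: F.m_assoc)
    finally show ?thesis using x by simp
  qed
  ultimately have "x \<in> N'" "x \<notin> N"
    using N'I x(1) by blast+
  then have "N \<subset> N'"
    using N_sub by blast
  with normal show thesis
    by (rule that) (use moved in \<open>auto simp: E_def\<close>)
qed

end

section \<open>Left nilpotency and the residual\<close>

context skew_brace
begin

text \<open>
  Both groups of \<open>X\<close> are \<open>p\<close>-groups and the multiplicative one acts on the additive one by \<open>\<lambda>\<close>.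
  If \<open>N' \<supseteq> N\<close> are \<open>\<lambda>\<close>-invariant and \<open>\<lambda>\<close> is trivial on \<open>N'/N\<close>, then \<open>X * N' \<subseteq> N\<close>; so once the left
  series lies in \<open>N'\<close>, its next term lies in \<open>N\<close>. Descending from \<open>X\<close> in this way, the left series
  comes to lie in every \<open>\<lambda>\<close>-invariant normal subgroup, and at last in \<open>{\<zero>}\<close>.
\<close>

theorem left_nilpotent_of_prime_power_card:
  assumes fin: "finite (carrier X)" and p: "prime p" and card: "card (carrier X) = p ^ n"
  shows "left_nilpotent X"
proof -
  let ?A = "add_monoid X" and ?l = "brace_lambda X"
  have finA: "finite (carrier ?A)" and ordA: "order ?A = p ^ n" and ordM: "order X = p ^ n"
    using fin card by (simp_all add: order_def)
  have "\<exists>m. left_series X m \<subseteq> N"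
    if "N \<lhd> ?A" "\<And>a x. \<lbrakk>a \<in> carrier X; x \<in> N\<rbrakk> \<Longrightarrow> ?l a x \<in> N" for N
    using that
  proof (induction "card (carrier X) - card N" arbitrary: N rule: less_induct)
    case less
    interpret N: normal N ?A by fact
    show ?case
    proof (cases "N = carrier X")
      case True
      then have "left_series X 0 \<subseteq> N" by simp
      then show ?thesis ..
    next
      case False
      obtain N' where N': "N' \<lhd> ?A" "N \<subset> N'"
        "\<And>a x. \<lbrakk>a \<in> carrier X; x \<in> N'\<rbrakk> \<Longrightarrow> ?l a x \<otimes>\<^bsub>?A\<^esub> inv\<^bsub>?A\<^esub> x \<in> N"
      proof (rule additive.exists_larger_normal_subgroup_fixed_mod[OF finA p ordA
            multiplicative.is_group ordM, where \<phi> = ?l and N = N])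
        show "?l a \<in> hom ?A ?A" if "a \<in> carrier X" for a
          using lambda_group_hom[OF that] by (rule group_hom.homh)
      qed (use less.prems False lambda_one lambda_mult in auto)
      interpret N': normal N' ?A by fact
      have sub: "N' \<subseteq> carrier X" using N'.subset by simp
      have "card N < card N'" "card N' \<le> card (carrier X)"
        using N'(2) sub fin by (auto intro: psubset_card_mono card_mono finite_subset)
      then have "card (carrier X) - card N' < card (carrier X) - card N" by simp
      moreover have "?l a x \<in> N'" if a: "a \<in> carrier X" and x: "x \<in> N'" for a x
      proof -
        have "?l a x \<otimes>\<^bsub>?A\<^esub> inv\<^bsub>?A\<^esub> x \<in> N'"
          using N'(2) N'(3)[OF a x] by blast
        then have "(?l a x \<otimes>\<^bsub>?A\<^esub> inv\<^bsub>?A\<^esub> x) \<otimes>\<^bsub>?A\<^esub> x \<in> N'"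
          using x by (rule N'.m_closed)
        then show ?thesis
          using additive.m_assoc[of "?l a x" "inv\<^bsub>?A\<^esub> x" x] additive.l_inv[of x]
            additive.r_one[of "?l a x"] additive.inv_closed[of x] lambda_closed[OF a] x sub
          by (simp add: subset_iff)
      qed
      ultimately obtain m where m: "left_series X m \<subseteq> N'"
        using less.hyps[OF _ N'(1)] by blast
      \<comment> \<open>The generators \<open>\<lambda>\<^sub>s(t) - t\<close> of the next term lie in \<open>N\<close>, because \<open>t\<close> lies in \<open>N'\<close>.\<close>
      have "left_series X (Suc m) \<subseteq> N"
        unfolding left_series.simps brace_set_star_def
      proof (rule additive.generate_subgroup_incl)
        show "{brace_star X s t |s t. s \<in> carrier X \<and> t \<in> left_series X m} \<subseteq> N"
          using N'(3) m by (auto simp: brace_star_def a_minus_def a_inv_def)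
      qed (rule N.subgroup_axioms)
      then show ?thesis ..
    qed
  qed
  from this[OF additive.one_is_normal] obtain m where m: "left_series X m \<subseteq> {\<zero>}"
    using group_hom.hom_one[OF lambda_group_hom] by auto
  have "\<zero> \<in> left_series X m"
    using zero_closed generate.one[of ?A] by (cases m) (simp_all add: brace_set_star_def)
  then show ?thesis
    using m by (auto simp: left_nilpotent_def)
qed

text \<open>
  An intersection of normal subgroups is normal once the family is nonempty, and the family that
  defines the residual contains \<open>X\<close>, because \<open>X/X\<close> is left nilpotent.
\<close>

lemma left_nilpotent_residual_normal:
  "left_nilpotent_residual X \<lhd> add_monoid X"
proof -
  let ?I = "{I. brace_ideal X I \<and> left_nilpotent (X Quot I)}" and ?A = "add_monoid X"
  have self: "carrier X \<lhd> ?A" "carrier X \<lhd> X"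
    using additive.normal_self multiplicative.normal_self by simp_all
  then have "brace_ideal X (carrier X)"
    unfolding brace_ideal_def using normal_imp_subgroup by auto
  moreover have "carrier (X Quot carrier X) = {carrier X}"
  proof -
    have "carrier X +> a = carrier X" if "a \<in> carrier X" for a
      using additive.coset_join2[OF _ additive.subgroup_self] that by (simp add: a_r_coset_def)
    then show ?thesis
      using zero_closed by (auto simp: FactRing_def A_RCOSETS_def')
  qed
  then have "left_series (X Quot carrier X) 0 = {\<zero>\<^bsub>X Quot carrier X\<^esub>}"
    by (simp add: FactRing_def)
  then have "left_nilpotent (X Quot carrier X)"
    unfolding left_nilpotent_def ..
  ultimately have ne: "?I \<noteq> {}" by blast
  have normal: "I \<lhd> ?A" if "I \<in> ?I" for I
    using that by (simp add: brace_ideal_def)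
  show ?thesis
    unfolding left_nilpotent_residual_def
  proof (rule additive.normal_invI)
    show "subgroup (\<Inter>?I) ?A"
      using ne normal_imp_subgroup[OF normal] by (intro additive.subgroups_Inter)
    show "g \<otimes>\<^bsub>?A\<^esub> x \<otimes>\<^bsub>?A\<^esub> inv\<^bsub>?A\<^esub> g \<in> \<Inter>?I"
      if "g \<in> carrier ?A" "x \<in> \<Inter>?I" for g x
      using that normal.inv_op_closed2[OF normal] by blast
  qed
qed

text \<open>
  Pure counting: \<open>|R + P| |R \<inter> P| = |R| |P| = |X| |R|\<^sub>p\<close>, where \<open>|R + P| \<le> |X|\<close>, and \<open>|R \<inter> P| \<le> |R|\<^sub>p\<close>
  because \<open>R \<inter> P\<close> is a subgroup of \<open>R\<close> of \<open>p\<close>-power order. Hence both bounds are attained.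
\<close>

lemma sylow_supplements_normal_of_prime_power_index:
  assumes fin: "finite (carrier X)" and p: "prime p"
    and R: "R \<lhd> add_monoid X" and index: "card (carrier X) = p ^ a * card R"
    and P: "sylow_subskew_brace p X P"
  shows "carrier X = R <+>\<^bsub>X\<^esub> P" and "card (P \<inter> R) = p_part p (card R)"
proof -
  let ?A = "add_monoid X"
  have Rs: "subgroup R ?A" using R by (rule normal_imp_subgroup)
  have Ps: "subgroup P ?A" and cP: "card P = p_part p (card (carrier X))"
    using P by (auto simp: sylow_subskew_brace_def subskew_brace_def)
  have sub: "R \<subseteq> carrier X" "P \<subseteq> carrier X"
    using subgroup.subset[OF Rs] subgroup.subset[OF Ps] by auto
  have cR: "card R > 0"
    using sub fin subgroup.one_closed[OF Rs] by (metis card_gt_0_iff emptyE finite_subset)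
  have "multiplicity p (p ^ a * card R) = a + multiplicity p (card R)"
    using p cR by (subst prime_elem_multiplicity_mult_distrib) auto
  then have cP': "card P = p ^ a * p_part p (card R)"
    using cP index by (simp add: p_part_def power_add)
  have "card (R <+>\<^bsub>X\<^esub> P) * card (R \<inter> P) = card R * card P"
    using additive.card_set_mult_mult_card_Int[OF Rs Ps] by (simp add: set_add_def)
  then have prod: "card (R <+>\<^bsub>X\<^esub> P) * card (P \<inter> R) = card (carrier X) * p_part p (card R)"
    using cP' index by (simp add: Int_commute mult_ac)
  have PR: "subgroup (P \<inter> R) ?A"
    using Ps Rs by (rule additive.subgroups_Inter_pair)
  have "card (P \<inter> R) dvd card P" "card (P \<inter> R) dvd card R"
    using additive.card_subgroup_dvd_card[OF PR] Ps Rs by simp_all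
  then have dvd: "card (P \<inter> R) dvd p ^ multiplicity p (card (carrier X))"
    "card (P \<inter> R) dvd card R"
    using cP by (simp_all add: p_part_def)
  then obtain i where i: "card (P \<inter> R) = p ^ i"
    using divides_primepow_nat[OF p] by blast
  then have "i \<le> multiplicity p (card R)"
    using dvd(2) cR p by (intro multiplicity_geI) auto
  then have le_PR: "card (P \<inter> R) \<le> p_part p (card R)"
    unfolding i p_part_def using prime_ge_1_nat[OF p] by (rule power_increasing)
  have RP: "R <+>\<^bsub>X\<^esub> P \<subseteq> carrier X"
    using sub add_closed by (auto simp: set_add_def')
  then have le_RP: "card (R <+>\<^bsub>X\<^esub> P) \<le> card (carrier X)"
    using fin by (simp add: card_mono)
  have pos: "card (carrier X) > 0" "p_part p (card R) > 0"
    using index cR p by (simp_all add: p_part_def prime_gt_0_nat)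
  have "card (carrier X) * p_part p (card R) \<le> card (carrier X) * card (P \<inter> R)"
    using mult_le_mono1[OF le_RP, of "card (P \<inter> R)"] prod by simp
  then show eq: "card (P \<inter> R) = p_part p (card R)"
    using le_PR pos by simp
  then have "card (R <+>\<^bsub>X\<^esub> P) = card (carrier X)"
    using prod pos by simp
  then show "carrier X = R <+>\<^bsub>X\<^esub> P"
    using RP fin by (metis card_subset_eq)
qed

end

theorem proposition8p5:
  fixes X :: "('a, 'b) ring_scheme" (structure)
    and R :: "'a set" and Q :: "'a set ring" and p a :: nat
  assumes "skew_brace X"
    and "finite (carrier X)"
    and "R = left_nilpotent_residual X"
    and "Q = X Quot R"
    and "prime p"
    and "card (carrier Q) = p ^ a"
  shows "(\<forall>P. sylow_subskew_brace p X P \<longrightarrow>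
            supplements X P R \<and>
            carrier X = R <+>\<^bsub>X\<^esub> P \<and>
            card (P \<inter> R) = p_part p (card R)) \<and>
         (\<exists>C. supplements X C R \<and> left_nilpotent (X\<lparr>carrier := C\<rparr>))"
proof -
  interpret skew_brace X by fact
  note fin = assms(2) and p = assms(5)
  have R: "R \<lhd> add_monoid X"
    unfolding assms(3) by (rule left_nilpotent_residual_normal)
  have "carrier Q = rcosets\<^bsub>add_monoid X\<^esub> R"
    by (simp add: assms(4) FactRing_def A_RCOSETS_def)
  then have "card (carrier X) = p ^ a * card R"
    using additive.lagrange[OF normal_imp_subgroup[OF R]] assms(6) by (simp add: order_def)
  note sylow = sylow_supplements_normal_of_prime_power_index[OF fin p R this]
  have all: "supplements X P R \<and> carrier X = R <+>\<^bsub>X\<^esub> P \<and> card (P \<inter> R) = p_part p (card R)"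
    if P: "sylow_subskew_brace p X P" for P
    using sylow[OF P] P by (simp add: supplements_def sylow_subskew_brace_def)
  obtain P where P: "sylow_subskew_brace p X P"
    using exists_sylow_subskew_brace[OF fin p] by blast
  then have sub: "subskew_brace X P" and card: "card P = p ^ multiplicity p (card (carrier X))"
    by (simp_all add: sylow_subskew_brace_def p_part_def)
  interpret P: skew_brace "X\<lparr>carrier := P\<rparr>"
    using sub by (rule subskew_brace_imp_skew_brace)
  have "finite P"
    using sub fin subgroup.subset finite_subset unfolding subskew_brace_def by blast
  then have "left_nilpotent (X\<lparr>carrier := P\<rparr>)"
    using P.left_nilpotent_of_prime_power_card[OF _ p] card by simp
  then show ?thesis
    using all P by blast
qed

end
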